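(* Let $\Delta$ be the root system of type $H(4,1)$. Then $\alpha,\beta,\gamma$ are real roots of $\Delta$ with $\alpha+\beta+\gamma=0$ if and only if $$\{\alpha,\beta,\gamma\}=\{\alpha^{SU}_j,\alpha^{SU}_{2k+1-j},-\alpha^{LU}_k\}\quad\text{or}\quad\{\alpha,\beta,\gamma\}=\{\alpha^{SL}_j,\alpha^{SL}_{2k+1-j},-\alpha^{LL}_{k+1}\}$$ for some $j,k\in\mathbb Z$. Furthermore, if $H\in\{U,L\}$, $j,k\in\mathbb Z$, and we set $\alpha=\alpha^{SH}_j$, $\beta=\alpha^{SH}_{2k+1-j}$, $\gamma=-(\alpha+\beta)$, then $$p_{\alpha,\beta}=p_{\beta,\alpha}=3,\qquad p_{\alpha,\gamma}=p_{\gamma,\alpha}=p_{\beta,\gamma}=p_{\gamma,\beta}=0.$$ That is, among ordered pairs of distinct roots of such a triple, the value of $p$ is $3$ for the pairs of two short roots (whose sum is long), and otherwise it is $0$.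
   Context: $\Delta$ is the root system of the (affine, type $A_2^{(2)}$) Kac--Moody algebra with generalized Cartan matrix $H(4,1)=\begin{pmatrix}2&-1\\-4&2\end{pmatrix}$. Simple roots are $\alpha_1,\alpha_2$; simple reflections $w_1(\alpha_1)=-\alpha_1$, $w_1(\alpha_2)=\alpha_2+\alpha_1$, $w_2(\alpha_1)=\alpha_1+4\alpha_2$, $w_2(\alpha_2)=-\alpha_2$; $W=\langle w_1,w_2\rangle$. Real roots are $W\alpha_1$ (long) and $W\alpha_2$ (short); imaginary roots are the nonzero integer multiples of $\alpha_1+2\alpha_2$; $\Delta$ is the set of all of these. For $j\in\mathbb Z$: $\alpha^{LL}_j=(w_1w_2)^j\alpha_1$, $\alpha^{LU}_j=(w_2w_1)^jw_2\alpha_1$, $\alpha^{SU}_j=(w_2w_1)^j\alpha_2$, $\alpha^{SL}_j=(w_1w_2)^jw_1\alpha_2$. For roots $\mu,\nu$, the $\mu$-root string through $\nu$ is $\nu-p_{\mu,\nu}\mu,\dots,\nu,\dots,\nu+q_{\mu,\nu}\mu$; that is, $p_{\mu,\nu}$ is the largest integer $p\ge0$ with $\nu-p\mu\in\Delta$. *)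

theory Defs
  imports "HOL-Analysis.Cartesian_Space"
    "HOL-Algebra.Bij" "HOL-Algebra.Generated_Groups"
begin

text \<open>
  The root lattice is \<open>int ^ 2\<close>: the vector with components \<open>a\<close>, \<open>b\<close> stands for
  \<open>a \<alpha>\<^sub>1 + b \<alpha>\<^sub>2\<close>.
\<close>

definition H41 :: "int ^ 2 ^ 2" where
  "H41 = vector [vector [2, -1], vector [-4, 2]]"

definition simple_root :: "2 \<Rightarrow> int ^ 2" where
  "simple_root i = axis i 1"

text \<open>
  The reflection \<open>w\<^sub>i\<close> is the linear map with \<open>w\<^sub>i \<alpha>\<^sub>j = \<alpha>\<^sub>j - a\<^sub>i\<^sub>j \<alpha>\<^sub>i\<close>, where
  \<open>a\<^sub>i\<^sub>j\<close> are the entries of \<open>H41\<close>.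
\<close>

definition simple_reflection :: "2 \<Rightarrow> int ^ 2 \<Rightarrow> int ^ 2" where
  "simple_reflection i v = v - ((H41 *v v) $ i) *s simple_root i"

lemma simple_reflection_simple_root:
  "simple_reflection 1 (simple_root 1) = - simple_root 1"
  "simple_reflection 1 (simple_root 2) = simple_root 2 + simple_root 1"
  "simple_reflection 2 (simple_root 1) = simple_root 1 + 4 *s simple_root 2"
  "simple_reflection 2 (simple_root 2) = - simple_root 2"
  by (simp_all add: simple_reflection_def simple_root_def H41_def vec_eq_iff forall_2
      matrix_vector_mult_def sum_2 axis_def)

abbreviation lattice_perms :: "(int ^ 2 \<Rightarrow> int ^ 2) monoid" where
  "lattice_perms \<equiv> BijGroup UNIV"

lemma simple_reflection_in_lattice_perms: "simple_reflection i \<in> carrier lattice_perms"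
proof -
  have "simple_reflection i (simple_reflection i v) = v" for v
    using exhaust_2[of i]
    by (auto simp: simple_reflection_def simple_root_def H41_def vec_eq_iff forall_2
        matrix_vector_mult_def sum_2 axis_def)
  then have "bij (simple_reflection i)"
    by (rule involuntory_imp_bij)
  then show ?thesis
    by (simp add: BijGroup_def Bij_def)
qed

definition weyl_group :: "(int ^ 2 \<Rightarrow> int ^ 2) set" where
  "weyl_group = generate lattice_perms {simple_reflection 1, simple_reflection 2}"

definition long_roots :: "(int ^ 2) set" where
  "long_roots = {w (simple_root 1) | w. w \<in> weyl_group}"

definition short_roots :: "(int ^ 2) set" where
  "short_roots = {w (simple_root 2) | w. w \<in> weyl_group}"

definition real_roots :: "(int ^ 2) set" where
  "real_roots = long_roots \<union> short_roots"

definition imaginary_roots :: "(int ^ 2) set" where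
  "imaginary_roots = {m *s (simple_root 1 + 2 *s simple_root 2) | m. m \<noteq> 0}"

definition roots :: "(int ^ 2) set" where
  "roots = real_roots \<union> imaginary_roots"

text \<open>The maps \<open>(w\<^sub>1 w\<^sub>2)\<^sup>j\<close> and \<open>(w\<^sub>2 w\<^sub>1)\<^sup>j\<close> for an integer exponent \<open>j\<close>.\<close>

definition w12_pow :: "int \<Rightarrow> int ^ 2 \<Rightarrow> int ^ 2" where
  "w12_pow j =
    (simple_reflection 1 \<otimes>\<^bsub>lattice_perms\<^esub> simple_reflection 2) [^]\<^bsub>lattice_perms\<^esub> j"

definition w21_pow :: "int \<Rightarrow> int ^ 2 \<Rightarrow> int ^ 2" where
  "w21_pow j =
    (simple_reflection 2 \<otimes>\<^bsub>lattice_perms\<^esub> simple_reflection 1) [^]\<^bsub>lattice_perms\<^esub> j"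

definition alpha_LL :: "int \<Rightarrow> int ^ 2" where
  "alpha_LL j = w12_pow j (simple_root 1)"

definition alpha_LU :: "int \<Rightarrow> int ^ 2" where
  "alpha_LU j = w21_pow j (simple_reflection 2 (simple_root 1))"

definition alpha_SU :: "int \<Rightarrow> int ^ 2" where
  "alpha_SU j = w21_pow j (simple_root 2)"

definition alpha_SL :: "int \<Rightarrow> int ^ 2" where
  "alpha_SL j = w12_pow j (simple_reflection 1 (simple_root 2))"

text \<open>
  \<open>string_p \<mu> \<nu>\<close> is \<open>p\<^sub>\<mu>\<^sub>,\<^sub>\<nu>\<close>, meant for roots \<open>\<mu>\<close>, \<open>\<nu>\<close> with \<open>\<mu>\<close> real: only then is the
  set of admissible \<open>p\<close> bounded, so that a greatest element exists.
\<close>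

definition string_p :: "int ^ 2 \<Rightarrow> int ^ 2 \<Rightarrow> nat" where
  "string_p \<mu> \<nu> = (GREATEST p. \<nu> - int p *s \<mu> \<in> roots)"

end

theory Submission
  imports Defs
begin

text \<open>
  Write \<open>\<delta> = \<alpha>\<^sub>1 + 2 \<alpha>\<^sub>2\<close> and use \<open>\<delta>\<close>, \<open>\<alpha>\<^sub>2\<close> as a basis of the root lattice. Both simple
  reflections fix \<open>\<delta>\<close> and negate the coefficient of \<open>\<alpha>\<^sub>2\<close> modulo \<open>\<delta>\<close>, so every Weyl group element
  sends \<open>n \<delta> + e \<alpha>\<^sub>2\<close> to \<open>(n + k e) \<delta> \<plusminus> e \<alpha>\<^sub>2\<close>, where \<open>k\<close> does not depend on the vector
  (\<open>weyl_group_delta_coords\<close>). As \<open>\<alpha>\<^sub>1 = \<delta> - 2 \<alpha>\<^sub>2\<close>, this makes the roots completely explicit: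
  the short ones are \<open>n \<delta> \<plusminus> \<alpha>\<^sub>2\<close> with \<open>n\<close> arbitrary, the long ones \<open>n \<delta> \<plusminus> 2 \<alpha>\<^sub>2\<close> with \<open>n\<close> odd, and the
  imaginary ones \<open>n \<delta>\<close> with \<open>n \<noteq> 0\<close>. The families \<open>SU\<close>, \<open>SL\<close>, \<open>LU\<close>, \<open>LL\<close> are those with coefficient
  \<open>1\<close>, \<open>-1\<close>, \<open>2\<close>, \<open>-2\<close> of \<open>\<alpha>\<^sub>2\<close>, because \<open>w\<^sub>1 w\<^sub>2\<close> and \<open>w\<^sub>2 w\<^sub>1\<close> act as shears.

  Three numbers from \<open>{1, -1, 2, -2}\<close> sum to zero only as \<open>e + e - 2 e\<close> with \<open>e = \<plusminus>1\<close>. So a zero-sum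
  triple of real roots consists of two short roots with the same \<open>e\<close> and of the negative of their sum,
  and the only remaining condition is that the two coefficients of \<open>\<delta>\<close> have odd sum
  (\<open>real_root_triple_iff\<close>). The sign \<open>e\<close> separates the two families of triples.

  The coefficient of \<open>\<alpha>\<^sub>2\<close> along a root string is an arithmetic progression, and it must stay in
  \<open>{-2, ..., 2}\<close>. For two short roots it descends as \<open>e, 0, -e, -2 e, -3 e\<close>, so the string has at most
  three further terms; these are roots by the parity condition. For a short and a long member of
  the triple the signs are opposite, and the first step already leaves the range.
\<close>

section \<open>Coordinates along the null root\<close>

text \<open>
  This is \<open>n \<delta> + e \<alpha>\<^sub>2\<close>. The pair \<open>\<delta>\<close>, \<open>\<alpha>\<^sub>2\<close> is a basis of the lattice in which both reflections
  are triangular with diagonal \<open>1\<close>, \<open>-1\<close>.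
\<close>

definition delta_vec :: "int \<Rightarrow> int \<Rightarrow> int ^ 2" where
  "delta_vec n e = vector [n, 2 * n + e]"

lemma delta_vec_eq_iff [simp]: "delta_vec n e = delta_vec n' e' \<longleftrightarrow> n = n' \<and> e = e'"
  by (auto simp: delta_vec_def vec_eq_iff forall_2)

lemma delta_vec_arith [simp]:
  "delta_vec n e + delta_vec n' e' = delta_vec (n + n') (e + e')"
  "delta_vec n e - delta_vec n' e' = delta_vec (n - n') (e - e')"
  "- delta_vec n e = delta_vec (- n) (- e)"
  "c *s delta_vec n e = delta_vec (c * n) (c * e)"
  by (simp_all add: delta_vec_def vec_eq_iff forall_2 algebra_simps)

lemma delta_vec_eq_0_iff [simp]: "delta_vec n e = 0 \<longleftrightarrow> n = 0 \<and> e = 0"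
  by (auto simp: delta_vec_def vec_eq_iff forall_2)

lemma delta_vec_cases:
  obtains n e where "v = delta_vec n e"
proof
  show "v = delta_vec (v $ 1) (v $ 2 - 2 * v $ 1)"
    by (simp add: delta_vec_def vec_eq_iff forall_2)
qed

lemma simple_root_eq_delta_vec:
  "simple_root 1 = delta_vec 1 (-2)" "simple_root 2 = delta_vec 0 1"
  by (simp_all add: simple_root_def delta_vec_def vec_eq_iff forall_2 axis_def)

lemma simple_reflection_delta_vec [simp]:
  "simple_reflection 1 (delta_vec n e) = delta_vec (n + e) (- e)"
  "simple_reflection 2 (delta_vec n e) = delta_vec n (- e)"
  by (simp_all add: simple_reflection_def simple_root_def delta_vec_def H41_def vec_eq_iff
      forall_2 matrix_vector_mult_def sum_2 axis_def)

lemma simple_reflection_involutive: "simple_reflection i (simple_reflection i v) = v"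
  using exhaust_2[of i] by (cases v rule: delta_vec_cases) auto

section \<open>The Weyl group action and the roots in coordinates\<close>

interpretation lattice_perms: group lattice_perms
  by (rule group_BijGroup)

lemma lattice_perms_mult_apply:
  assumes "f \<in> carrier lattice_perms" "g \<in> carrier lattice_perms"
  shows "(f \<otimes>\<^bsub>lattice_perms\<^esub> g) v = f (g v)"
  using assms by (simp add: BijGroup_def compose_def)

lemma lattice_perms_one_apply [simp]: "\<one>\<^bsub>lattice_perms\<^esub> v = v"
  by (simp add: BijGroup_def)

lemma lattice_perms_inv_simple_reflection:
  "inv\<^bsub>lattice_perms\<^esub> (simple_reflection i) = simple_reflection i"
proof (rule lattice_perms.inv_equality)
  show "simple_reflection i \<otimes>\<^bsub>lattice_perms\<^esub> simple_reflection i = \<one>\<^bsub>lattice_perms\<^esub>"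
    by (rule ext) (simp add: lattice_perms_mult_apply simple_reflection_in_lattice_perms
        simple_reflection_involutive)
qed (rule simple_reflection_in_lattice_perms)+

lemma simple_reflections_subset: "{simple_reflection 1, simple_reflection 2} \<subseteq> carrier lattice_perms"
  by (simp add: simple_reflection_in_lattice_perms)

lemma subgroup_weyl_group: "subgroup weyl_group lattice_perms"
  unfolding weyl_group_def
  by (rule lattice_perms.generate_is_subgroup[OF simple_reflections_subset])

lemma simple_reflection_in_weyl_group: "simple_reflection i \<in> weyl_group"
  using exhaust_2[of i] by (auto simp: weyl_group_def intro: generate.incl)

lemma weyl_group_delta_coords:
  assumes "w \<in> weyl_group"
  shows "\<exists>k s. (s = 1 \<or> s = -1) \<and> (\<forall>n e. w (delta_vec n e) = delta_vec (n + k * e) (s * e))"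
  using assms unfolding weyl_group_def
proof (induction rule: generate.induct)
  case one
  show ?case by (intro exI[of _ 0] exI[of _ 1]) simp
next
  case (incl w)
  then show ?case
  proof (elim insertE)
    assume "w = simple_reflection 1"
    then show ?thesis by (intro exI[of _ 1] exI[of _ "-1"]) simp
  next
    assume "w = simple_reflection 2"
    then show ?thesis by (intro exI[of _ 0] exI[of _ "-1"]) simp
  qed simp
next
  case (inv w)
  then show ?case
  proof (elim insertE)
    assume "w = simple_reflection 1"
    then show ?thesis
      by (intro exI[of _ 1] exI[of _ "-1"]) (simp add: lattice_perms_inv_simple_reflection)
  next
    assume "w = simple_reflection 2"
    then show ?thesis
      by (intro exI[of _ 0] exI[of _ "-1"]) (simp add: lattice_perms_inv_simple_reflection)
  qed simp
next
  case (eng w w')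
  then obtain k s k' s' where
    w: "s = 1 \<or> s = -1" "\<And>n e. w (delta_vec n e) = delta_vec (n + k * e) (s * e)" and
    w': "s' = 1 \<or> s' = -1" "\<And>n e. w' (delta_vec n e) = delta_vec (n + k' * e) (s' * e)"
    by blast
  have "w \<in> carrier lattice_perms" "w' \<in> carrier lattice_perms"
    using eng.hyps lattice_perms.generate_in_carrier[OF simple_reflections_subset] by auto
  then have "(w \<otimes>\<^bsub>lattice_perms\<^esub> w') (delta_vec n e) =
      delta_vec (n + (k' + k * s') * e) (s * s' * e)" for n e
    by (simp add: lattice_perms_mult_apply w(2) w'(2) algebra_simps)
  moreover have "s * s' = 1 \<or> s * s' = -1"
    using w(1) w'(1) by auto
  ultimately show ?case by blast
qed

text \<open>
  Evaluating \<open>g\<^sup>j\<^sup>+\<^sup>1 = g\<^sup>j g\<close> at a vector determines \<open>g\<^sup>j\<^sup>+\<^sup>1\<close> from \<open>g\<^sup>j\<close>, and, at the preimage of a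
  vector under the shear, also \<open>g\<^sup>j\<close> from \<open>g\<^sup>j\<^sup>+\<^sup>1\<close>; thus both directions of the induction over the
  integers use the same equation.
\<close>

lemma int_pow_shear:
  fixes j s :: int
  assumes g: "g \<in> carrier lattice_perms"
    and shear: "\<And>n e. g (delta_vec n e) = delta_vec (n + s * e) e"
  shows "(g [^]\<^bsub>lattice_perms\<^esub> j) (delta_vec n e) = delta_vec (n + j * s * e) e"
proof -
  have step: "(g [^]\<^bsub>lattice_perms\<^esub> (i + 1)) (delta_vec n e) =
      (g [^]\<^bsub>lattice_perms\<^esub> i) (delta_vec (n + s * e) e)" for i :: int and n
    using g by (simp add: lattice_perms.int_pow_mult lattice_perms_mult_apply shear)
  show ?thesis
  proof (induction j arbitrary: n rule: int_induct[where k = 0])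
    case base
    show ?case by simp
  next
    case (step1 i)
    show ?case unfolding step step1.IH by (simp add: algebra_simps)
  next
    case (step2 i)
    have "(g [^]\<^bsub>lattice_perms\<^esub> (i - 1)) (delta_vec n e) =
        (g [^]\<^bsub>lattice_perms\<^esub> i) (delta_vec (n - s * e) e)"
      using step[of "i - 1" "n - s * e"] by simp
    then show ?case by (simp add: step2.IH algebra_simps)
  qed
qed

lemma w12_pow_delta_vec: "w12_pow j (delta_vec n e) = delta_vec (n - j * e) e"
proof -
  have "(simple_reflection 1 \<otimes>\<^bsub>lattice_perms\<^esub> simple_reflection 2) (delta_vec n e) =
      delta_vec (n + (-1) * e) e" for n e
    by (simp add: lattice_perms_mult_apply simple_reflection_in_lattice_perms)
  from int_pow_shear[OF _ this] show ?thesis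
    by (simp add: w12_pow_def simple_reflection_in_lattice_perms)
qed

lemma w21_pow_delta_vec: "w21_pow j (delta_vec n e) = delta_vec (n + j * e) e"
proof -
  have "(simple_reflection 2 \<otimes>\<^bsub>lattice_perms\<^esub> simple_reflection 1) (delta_vec n e) =
      delta_vec (n + 1 * e) e" for n e
    by (simp add: lattice_perms_mult_apply simple_reflection_in_lattice_perms)
  from int_pow_shear[OF _ this] show ?thesis
    by (simp add: w21_pow_def simple_reflection_in_lattice_perms)
qed

lemma alpha_eq_delta_vec:
  "alpha_SU j = delta_vec j 1"
  "alpha_SL j = delta_vec (j + 1) (-1)"
  "alpha_LU j = delta_vec (2 * j + 1) 2"
  "alpha_LL j = delta_vec (2 * j + 1) (-2)"
  by (simp_all add: alpha_SU_def alpha_SL_def alpha_LU_def alpha_LL_def simple_root_eq_delta_vec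
      w12_pow_delta_vec w21_pow_delta_vec)

lemma w12_pow_in_weyl_group: "w12_pow j \<in> weyl_group"
  unfolding w12_pow_def
  by (intro lattice_perms.subgroup_int_pow_closed subgroup_weyl_group
      subgroup.m_closed[OF subgroup_weyl_group] simple_reflection_in_weyl_group)

lemma w21_pow_in_weyl_group: "w21_pow j \<in> weyl_group"
  unfolding w21_pow_def
  by (intro lattice_perms.subgroup_int_pow_closed subgroup_weyl_group
      subgroup.m_closed[OF subgroup_weyl_group] simple_reflection_in_weyl_group)

lemma weyl_group_comp_simple_reflection:
  assumes "w \<in> weyl_group"
  obtains w' where "w' \<in> weyl_group" "w' v = w (simple_reflection i v)"
proof
  show "w \<otimes>\<^bsub>lattice_perms\<^esub> simple_reflection i \<in> weyl_group"
    using assms simple_reflection_in_weyl_group by (rule subgroup.m_closed[OF subgroup_weyl_group])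
  show "(w \<otimes>\<^bsub>lattice_perms\<^esub> simple_reflection i) v = w (simple_reflection i v)"
    using subgroup.mem_carrier[OF subgroup_weyl_group assms]
    by (simp add: lattice_perms_mult_apply simple_reflection_in_lattice_perms)
qed

lemma alpha_SU_short: "alpha_SU j \<in> short_roots"
  using w21_pow_in_weyl_group[of j] by (auto simp: short_roots_def alpha_SU_def)

lemma alpha_SL_short: "alpha_SL j \<in> short_roots"
proof -
  obtain w where w: "w \<in> weyl_group" "w (simple_root 2) = alpha_SL j"
    unfolding alpha_SL_def by (rule weyl_group_comp_simple_reflection[OF w12_pow_in_weyl_group])
  show ?thesis unfolding short_roots_def w(2)[symmetric] using w(1) by blast
qed

lemma alpha_LL_long: "alpha_LL j \<in> long_roots"
  using w12_pow_in_weyl_group[of j] by (auto simp: long_roots_def alpha_LL_def)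

lemma alpha_LU_long: "alpha_LU j \<in> long_roots"
proof -
  obtain w where w: "w \<in> weyl_group" "w (simple_root 1) = alpha_LU j"
    unfolding alpha_LU_def by (rule weyl_group_comp_simple_reflection[OF w21_pow_in_weyl_group])
  show ?thesis unfolding long_roots_def w(2)[symmetric] using w(1) by blast
qed

lemma delta_vec_short_iff: "delta_vec n e \<in> short_roots \<longleftrightarrow> e = 1 \<or> e = -1"
proof
  assume "delta_vec n e \<in> short_roots"
  then obtain w where "w \<in> weyl_group" "delta_vec n e = w (delta_vec 0 1)"
    by (auto simp: short_roots_def simple_root_eq_delta_vec)
  then show "e = 1 \<or> e = -1"
    using weyl_group_delta_coords[of w] by auto
next
  assume "e = 1 \<or> e = -1"
  then show "delta_vec n e \<in> short_roots"
    using alpha_SU_short[of n] alpha_SL_short[of "n - 1"] by (auto simp: alpha_eq_delta_vec)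
qed

lemma delta_vec_long_iff: "delta_vec n e \<in> long_roots \<longleftrightarrow> odd n \<and> (e = 2 \<or> e = -2)"
proof
  assume "delta_vec n e \<in> long_roots"
  then obtain w where "w \<in> weyl_group" "delta_vec n e = w (delta_vec 1 (-2))"
    by (auto simp: long_roots_def simple_root_eq_delta_vec)
  then show "odd n \<and> (e = 2 \<or> e = -2)"
    using weyl_group_delta_coords[of w] by auto
next
  assume *: "odd n \<and> (e = 2 \<or> e = -2)"
  then obtain j where "n = 2 * j + 1" by (auto elim: oddE)
  with * show "delta_vec n e \<in> long_roots"
    using alpha_LU_long[of j] alpha_LL_long[of j] by (auto simp: alpha_eq_delta_vec)
qed

lemma delta_vec_real_iff:
  "delta_vec n e \<in> real_roots \<longleftrightarrow> e = 1 \<or> e = -1 \<or> odd n \<and> (e = 2 \<or> e = -2)"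
  by (auto simp: real_roots_def delta_vec_short_iff delta_vec_long_iff)

lemma delta_vec_roots_iff:
  "delta_vec n e \<in> roots \<longleftrightarrow>
    e = 0 \<and> n \<noteq> 0 \<or> e = 1 \<or> e = -1 \<or> odd n \<and> (e = 2 \<or> e = -2)"
proof -
  have "simple_root 1 + 2 *s simple_root 2 = delta_vec 1 0"
    by (simp add: simple_root_eq_delta_vec)
  then show ?thesis
    by (auto simp: roots_def delta_vec_real_iff imaginary_roots_def)
qed

section \<open>Zero-sum triples of real roots\<close>

text \<open>
  From left to right, the coefficients of \<open>\<alpha>\<^sub>2\<close> single out the long root, and its coefficient of \<open>\<delta>\<close>
  must be odd. From right to left, \<open>m + n\<close> odd forces \<open>m \<noteq> n\<close>, so the set on the right has three
  distinct members; hence the set equation determines \<open>\<alpha>\<close>, \<open>\<beta>\<close>, \<open>\<gamma>\<close> up to order, and their sum is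
  the sum over the set.
\<close>

lemma real_root_triple_iff:
  "\<alpha> \<in> real_roots \<and> \<beta> \<in> real_roots \<and> \<gamma> \<in> real_roots \<and> \<alpha> + \<beta> + \<gamma> = 0 \<longleftrightarrow>
    (\<exists>m n e. (e = 1 \<or> e = -1) \<and> odd (m + n) \<and>
      {\<alpha>, \<beta>, \<gamma>} = {delta_vec m e, delta_vec n e, - delta_vec (m + n) (2 * e)})"
  (is "?L \<longleftrightarrow> ?R")
proof
  assume L: ?L
  obtain a a' b b' c c' where v: "\<alpha> = delta_vec a a'" "\<beta> = delta_vec b b'" "\<gamma> = delta_vec c c'"
    by (metis delta_vec_cases)
  have sum: "a + b + c = 0" "a' + b' + c' = 0"
    using L by (auto simp: v)
  have c: "c = - (a + b)" and b: "b = - (a + c)" and a: "a = - (b + c)"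
    using sum by auto
  have parts: "a' = 1 \<or> a' = -1 \<or> odd a \<and> (a' = 2 \<or> a' = -2)"
    "b' = 1 \<or> b' = -1 \<or> odd b \<and> (b' = 2 \<or> b' = -2)"
    "c' = 1 \<or> c' = -1 \<or> odd c \<and> (c' = 2 \<or> c' = -2)"
    using L by (simp_all only: v delta_vec_real_iff)
  have "(a' = 1 \<or> a' = -1) \<and> b' = a' \<and> c' = - 2 * a' \<and> odd c \<or>
      (a' = 1 \<or> a' = -1) \<and> c' = a' \<and> b' = - 2 * a' \<and> odd b \<or>
      (b' = 1 \<or> b' = -1) \<and> c' = b' \<and> a' = - 2 * b' \<and> odd a"
    using parts sum(2) by (elim disjE conjE) simp_all
  then consider "a' = 1 \<or> a' = -1" "b' = a'" "c' = - 2 * a'" "odd c"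
    | "a' = 1 \<or> a' = -1" "c' = a'" "b' = - 2 * a'" "odd b"
    | "b' = 1 \<or> b' = -1" "c' = b'" "a' = - 2 * b'" "odd a"
    by argo
  then show ?R
  proof cases
    case 1
    then show ?R by (intro exI[of _ a] exI[of _ b] exI[of _ a']) (simp add: v c)
  next
    case 2
    then show ?R by (intro exI[of _ a] exI[of _ c] exI[of _ a']) (simp add: v b insert_commute)
  next
    case 3
    then show ?R by (intro exI[of _ b] exI[of _ c] exI[of _ b']) (simp add: v a insert_commute)
  qed
next
  assume ?R
  then obtain m n e where e: "e = 1 \<or> e = -1" and odd: "odd (m + n)"
    and eq: "{\<alpha>, \<beta>, \<gamma>} = {delta_vec m e, delta_vec n e, - delta_vec (m + n) (2 * e)}"
      (is "_ = {?x, ?y, ?z}")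
    by blast
  have "m \<noteq> n" using odd by auto
  with e have distinct: "?x \<noteq> ?y" "?x \<noteq> ?z" "?y \<noteq> ?z" by auto
  then have "card {\<alpha>, \<beta>, \<gamma>} = 3" unfolding eq by simp
  then have "\<alpha> \<noteq> \<beta>" "\<alpha> \<noteq> \<gamma>" "\<beta> \<noteq> \<gamma>"
    by (auto simp: card_insert_if split: if_splits)
  then have "\<alpha> + \<beta> + \<gamma> = \<Sum> {\<alpha>, \<beta>, \<gamma>}"
    by (simp add: add.assoc)
  also have "\<dots> = ?x + ?y + ?z"
    unfolding eq using distinct by (simp add: add.assoc del: delta_vec_arith)
  also have "\<dots> = 0" by simp
  finally have "\<alpha> + \<beta> + \<gamma> = 0" .
  moreover have "{\<alpha>, \<beta>, \<gamma>} \<subseteq> real_roots"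
    unfolding eq using e odd by (auto simp: delta_vec_real_iff)
  ultimately show ?L by simp
qed

section \<open>Root strings\<close>

lemma string_p_eqI:
  assumes "\<nu> - int p *s \<mu> \<in> roots" "\<And>q. p < q \<Longrightarrow> \<nu> - int q *s \<mu> \<notin> roots"
  shows "string_p \<mu> \<nu> = p"
  unfolding string_p_def using assms by (intro Greatest_equality) (auto simp: not_less[symmetric])

text \<open>
  The second term of the descending string is \<open>(n - m) \<delta>\<close>, a root since \<open>n - m\<close> is odd and hence
  nonzero; the fourth is \<open>(n - 3 m) \<delta> - 2 e \<alpha>\<^sub>2\<close>, a long root since \<open>n - 3 m\<close> is odd.
\<close>

lemma string_p_short_short:
  assumes "e = 1 \<or> e = -1" "odd (m + n)"
  shows "string_p (delta_vec m e) (delta_vec n e) = 3"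
  by (rule string_p_eqI) (use assms in \<open>auto simp: delta_vec_roots_iff\<close>)

lemma string_p_short_long:
  assumes "e = 1 \<or> e = -1" "odd l"
  shows "string_p (delta_vec m e) (- delta_vec l (2 * e)) = 0"
  by (rule string_p_eqI) (use assms in \<open>auto simp: delta_vec_roots_iff\<close>)

lemma string_p_long_short:
  assumes "e = 1 \<or> e = -1"
  shows "string_p (- delta_vec l (2 * e)) (delta_vec m e) = 0"
  by (rule string_p_eqI) (use assms in \<open>(auto simp: delta_vec_roots_iff, presburger+)\<close>)

section \<open>Classification of the triples and their string lengths\<close>

lemma alpha_triple_iff:
  "(\<exists>m n e. (e = 1 \<or> e = -1) \<and> odd (m + n) \<and>
      S = {delta_vec m e, delta_vec n e, - delta_vec (m + n) (2 * e)}) \<longleftrightarrow>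
    (\<exists>j k. S = {alpha_SU j, alpha_SU (2 * k + 1 - j), - alpha_LU k} \<or>
           S = {alpha_SL j, alpha_SL (2 * k + 1 - j), - alpha_LL (k + 1)})"
  (is "?L \<longleftrightarrow> ?R")
proof
  assume ?L
  then obtain m n e where e: "e = 1 \<or> e = -1" and odd: "odd (m + n)"
    and S: "S = {delta_vec m e, delta_vec n e, - delta_vec (m + n) (2 * e)}"
    by blast
  from odd obtain k where "m + n = 2 * k + 1" by (elim oddE)
  then have n: "n = 2 * k + 1 - m" by simp
  from e show ?R
  proof
    assume "e = 1"
    then have "S = {alpha_SU m, alpha_SU (2 * k + 1 - m), - alpha_LU k}"
      by (simp add: S n alpha_eq_delta_vec)
    then show ?R by blast
  next
    assume "e = -1"
    \<comment> \<open>\<open>alpha_SL j\<close> has \<open>j + 1\<close> as its coefficient of \<open>\<delta>\<close>, which shifts both indices by one.\<close>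
    then have "S = {alpha_SL (m - 1), alpha_SL (2 * (k - 1) + 1 - (m - 1)), - alpha_LL (k - 1 + 1)}"
      by (simp add: S n alpha_eq_delta_vec algebra_simps)
    then show ?R by blast
  qed
next
  assume ?R
  then obtain j k where
    "S = {alpha_SU j, alpha_SU (2 * k + 1 - j), - alpha_LU k} \<or>
     S = {alpha_SL j, alpha_SL (2 * k + 1 - j), - alpha_LL (k + 1)}" by blast
  then show ?L
  proof
    assume "S = {alpha_SU j, alpha_SU (2 * k + 1 - j), - alpha_LU k}"
    then show ?L
      by (intro exI[of _ j] exI[of _ "2 * k + 1 - j"] exI[of _ 1]) (simp add: alpha_eq_delta_vec)
  next
    assume "S = {alpha_SL j, alpha_SL (2 * k + 1 - j), - alpha_LL (k + 1)}"
    then show ?L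
      by (intro exI[of _ "j + 1"] exI[of _ "2 * k + 2 - j"] exI[of _ "-1"])
        (simp add: alpha_eq_delta_vec algebra_simps)
  qed
qed

lemma alpha_string_p:
  assumes "alpha_SH \<in> {alpha_SU, alpha_SL}"
    and \<alpha>\<beta>: "\<alpha> = alpha_SH j" "\<beta> = alpha_SH (2 * k + 1 - j)" and \<gamma>: "\<gamma> = - (\<alpha> + \<beta>)"
  shows "string_p \<alpha> \<beta> = 3 \<and> string_p \<beta> \<alpha> = 3 \<and>
    string_p \<alpha> \<gamma> = 0 \<and> string_p \<gamma> \<alpha> = 0 \<and>
    string_p \<beta> \<gamma> = 0 \<and> string_p \<gamma> \<beta> = 0"
proof -
  obtain m n e where e: "e = 1 \<or> e = -1" and odd: "odd (m + n)"
    and v: "\<alpha> = delta_vec m e" "\<beta> = delta_vec n e"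
    using assms(1)
  proof (elim insertE)
    assume "alpha_SH = alpha_SU"
    then show thesis using that[of 1 j "2 * k + 1 - j"] \<alpha>\<beta> by (simp add: alpha_eq_delta_vec)
  next
    assume "alpha_SH = alpha_SL"
    then show thesis
      using that[of "-1" "j + 1" "2 * k + 2 - j"] \<alpha>\<beta> by (simp add: alpha_eq_delta_vec)
  qed simp
  have odd': "odd (n + m)" using odd by (simp add: add.commute)
  have "\<gamma> = - delta_vec (m + n) (2 * e)"
    by (simp add: \<gamma> v)
  then show ?thesis
    using string_p_short_short[OF e odd] string_p_short_short[OF e odd']
      string_p_short_long[OF e odd] string_p_long_short[OF e]
    by (simp only: v simp_thms)
qed

lemma real_root_triple_string_p:
  assumes "\<alpha> \<in> real_roots" "\<beta> \<in> real_roots" "\<gamma> \<in> real_roots" "\<alpha> + \<beta> + \<gamma> = 0"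
    and "\<mu> \<in> {\<alpha>, \<beta>, \<gamma>}" "\<nu> \<in> {\<alpha>, \<beta>, \<gamma>}" "\<mu> \<noteq> \<nu>"
  shows "string_p \<mu> \<nu> = (if \<mu> \<in> short_roots \<and> \<nu> \<in> short_roots then 3 else 0) \<and>
    (\<mu> \<in> short_roots \<and> \<nu> \<in> short_roots \<longrightarrow> \<mu> + \<nu> \<in> long_roots)"
proof -
  obtain m n e where e: "e = 1 \<or> e = -1" and odd: "odd (m + n)"
    and eq: "{\<alpha>, \<beta>, \<gamma>} = {delta_vec m e, delta_vec n e, - delta_vec (m + n) (2 * e)}"
      (is "_ = {?x, ?y, ?z}")
    using iffD1[OF real_root_triple_iff, OF conjI[OF assms(1) conjI[OF assms(2) conjI[OF assms(3,4)]]]]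
    by (elim exE conjE)
  have odd': "odd (n + m)" using odd by (simp add: add.commute)
  have short: "?x \<in> short_roots" "?y \<in> short_roots" "?z \<notin> short_roots"
    using e by (auto simp: delta_vec_short_iff)
  have long: "?x + ?y \<in> long_roots" "?y + ?x \<in> long_roots"
    using e odd by (auto simp: delta_vec_long_iff)
  have "\<mu> \<in> {?x, ?y, ?z}" "\<nu> \<in> {?x, ?y, ?z}"
    using assms(5,6) by (simp_all only: eq)
  then consider "\<mu> = ?x" "\<nu> = ?y" | "\<mu> = ?y" "\<nu> = ?x" | "\<mu> = ?x \<or> \<mu> = ?y" "\<nu> = ?z"
    | "\<mu> = ?z" "\<nu> = ?x \<or> \<nu> = ?y"
    using assms(7) by (elim insertE emptyE) (simp_all only: simp_thms)
  then show ?thesis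
  proof cases
    case 1
    then show ?thesis using short long string_p_short_short[OF e odd] by (simp only: if_True simp_thms)
  next
    case 2
    then show ?thesis using short long string_p_short_short[OF e odd'] by (simp only: if_True simp_thms)
  next
    case 3
    then show ?thesis using short string_p_short_long[OF e odd] by (auto simp del: delta_vec_arith)
  next
    case 4
    then show ?thesis using short string_p_long_short[OF e] by (auto simp del: delta_vec_arith)
  qed
qed

theorem theorem7p1:
  shows
    "(\<forall>\<alpha> \<beta> \<gamma>.
        \<alpha> \<in> real_roots \<and> \<beta> \<in> real_roots \<and> \<gamma> \<in> real_roots \<and> \<alpha> + \<beta> + \<gamma> = 0 \<longleftrightarrow>
        (\<exists>j k. {\<alpha>, \<beta>, \<gamma>} = {alpha_SU j, alpha_SU (2 * k + 1 - j), - alpha_LU k} \<or>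
               {\<alpha>, \<beta>, \<gamma>} = {alpha_SL j, alpha_SL (2 * k + 1 - j), - alpha_LL (k + 1)}))
     \<and>
     (\<forall>alpha_SH \<in> {alpha_SU, alpha_SL}. \<forall>j k. \<forall>\<alpha> \<beta> \<gamma>.
        \<alpha> = alpha_SH j \<and> \<beta> = alpha_SH (2 * k + 1 - j) \<and> \<gamma> = - (\<alpha> + \<beta>) \<longrightarrow>
        string_p \<alpha> \<beta> = 3 \<and> string_p \<beta> \<alpha> = 3 \<and>
        string_p \<alpha> \<gamma> = 0 \<and> string_p \<gamma> \<alpha> = 0 \<and>
        string_p \<beta> \<gamma> = 0 \<and> string_p \<gamma> \<beta> = 0)
     \<and>
     (\<forall>\<alpha> \<beta> \<gamma>.
        \<alpha> \<in> real_roots \<and> \<beta> \<in> real_roots \<and> \<gamma> \<in> real_roots \<and> \<alpha> + \<beta> + \<gamma> = 0 \<longrightarrow>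
        (\<forall>\<mu> \<in> {\<alpha>, \<beta>, \<gamma>}. \<forall>\<nu> \<in> {\<alpha>, \<beta>, \<gamma>}. \<mu> \<noteq> \<nu> \<longrightarrow>
           string_p \<mu> \<nu> = (if \<mu> \<in> short_roots \<and> \<nu> \<in> short_roots then 3 else 0) \<and>
           (\<mu> \<in> short_roots \<and> \<nu> \<in> short_roots \<longrightarrow> \<mu> + \<nu> \<in> long_roots)))"
proof (intro conjI)
  show "\<forall>\<alpha> \<beta> \<gamma>.
      \<alpha> \<in> real_roots \<and> \<beta> \<in> real_roots \<and> \<gamma> \<in> real_roots \<and> \<alpha> + \<beta> + \<gamma> = 0 \<longleftrightarrow>
      (\<exists>j k. {\<alpha>, \<beta>, \<gamma>} = {alpha_SU j, alpha_SU (2 * k + 1 - j), - alpha_LU k} \<or>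
             {\<alpha>, \<beta>, \<gamma>} = {alpha_SL j, alpha_SL (2 * k + 1 - j), - alpha_LL (k + 1)})"
    by (intro allI) (rule trans[OF real_root_triple_iff alpha_triple_iff])
next
  show "\<forall>alpha_SH \<in> {alpha_SU, alpha_SL}. \<forall>j k. \<forall>\<alpha> \<beta> \<gamma>.
      \<alpha> = alpha_SH j \<and> \<beta> = alpha_SH (2 * k + 1 - j) \<and> \<gamma> = - (\<alpha> + \<beta>) \<longrightarrow>
      string_p \<alpha> \<beta> = 3 \<and> string_p \<beta> \<alpha> = 3 \<and>
      string_p \<alpha> \<gamma> = 0 \<and> string_p \<gamma> \<alpha> = 0 \<and>
      string_p \<beta> \<gamma> = 0 \<and> string_p \<gamma> \<beta> = 0"
    by (intro ballI allI impI, elim conjE) (rule alpha_string_p)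
next
  show "\<forall>\<alpha> \<beta> \<gamma>.
      \<alpha> \<in> real_roots \<and> \<beta> \<in> real_roots \<and> \<gamma> \<in> real_roots \<and> \<alpha> + \<beta> + \<gamma> = 0 \<longrightarrow>
      (\<forall>\<mu> \<in> {\<alpha>, \<beta>, \<gamma>}. \<forall>\<nu> \<in> {\<alpha>, \<beta>, \<gamma>}. \<mu> \<noteq> \<nu> \<longrightarrow>
         string_p \<mu> \<nu> = (if \<mu> \<in> short_roots \<and> \<nu> \<in> short_roots then 3 else 0) \<and>
         (\<mu> \<in> short_roots \<and> \<nu> \<in> short_roots \<longrightarrow> \<mu> + \<nu> \<in> long_roots))"
    by (intro ballI allI impI, elim conjE) (rule real_root_triple_string_p)
qed

end
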